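(* Let $0<q<1$ be fixed. Let $k,l$ be positive integers and $s,h,x$ be real numbers with $l>s\geq 0$, $k>h\geq 0$ and $|x|<1$. Then \begin{align*} &(-1)^{k-1}S\left[\left.\begin{matrix} l, & 1\\ q^s, & q^hx\end{matrix}\right|\begin{matrix} k\\ q^{k-h}\end{matrix}\right] - (-1)^{l-1}S\left[\left.\begin{matrix} k, & 1\\ q^h, & q^sx\end{matrix}\right|\begin{matrix} l\\ q^{l-s}\end{matrix}\right]\\ = &\sum_{j=1}^{l-1} (-1)^{j-1}\mathrm{Li}_{l+1-j}[q^sx]\,S\left[\left.\begin{matrix} k\\ q^h\end{matrix}\right|\begin{matrix} j\\ q^{j-1}x\end{matrix}\right] - \sum_{j=1}^{k-1} (-1)^{j-1}\mathrm{Li}_{k+1-j}[q^hx]\,S\left[\left.\begin{matrix} l\\ q^s\end{matrix}\right|\begin{matrix} j\\ q^{j-1}x\end{matrix}\right]\\ &\quad + (-1)^{l-1}\ln[1-q^sx]\left( S\left[\left.\begin{matrix} k\\ q^h\end{matrix}\right|\begin{matrix} l\\ q^{l-s}\end{matrix}\right] - S\left[\left.\begin{matrix} k\\ q^h\end{matrix}\right|\begin{matrix} l\\ q^{l-1}x\end{matrix}\right] \right)\\ &\quad - (-1)^{k-1}\ln[1-q^hx]\left(S\left[\left.\begin{matrix} l\\ q^s\end{matrix}\right|\begin{matrix} k\\ q^{k-h}\end{matrix}\right] - S\left[\left.\begin{matrix} l\\ q^s\end{matrix}\right|\begin{matrix} k\\ q^{k-1}x\end{matrix}\right] \right). \end{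align*}
   Context: Fix $0<q<1$ and set $[m]=\frac{1-q^m}{1-q}$. For a positive integer $k$ and $-1\le x\le 1$, $\zeta_m[k,x]:=\sum_{j=1}^m\frac{x^j}{[j]^k}$. For $|x|<1$, $\mathrm{Li}_k[x]:=\sum_{m=1}^\infty\frac{x^m}{[m]^k}$ and $\ln[1-x]:=-\mathrm{Li}_1[x]$. For positive integers $k_1,\ldots,k_n,k$, reals $x_1,\ldots,x_n\in[-1,1]$ and $x\in(-1,1)$, $$S\left[\left.\begin{matrix} k_1,\ldots,k_n\\ x_1,\ldots,x_n\end{matrix}\right|\begin{matrix} k\\ x\end{matrix}\right]:=\sum_{m=1}^\infty\frac{\zeta_m[k_1,x_1]\cdots\zeta_m[k_n,x_n]}{[m]^k}x^m.$$ *)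

theory Defs
  imports Complex_Main
begin

definition qbracket :: "real \<Rightarrow> nat \<Rightarrow> real" where
  "qbracket q m = (1 - q ^ m) / (1 - q)"

definition qzeta :: "real \<Rightarrow> nat \<Rightarrow> nat \<Rightarrow> real \<Rightarrow> real" where
  "qzeta q m k x = (\<Sum>j = 1..m. x ^ j / qbracket q j ^ k)"

(* The infinite series below start at index 1, hence the shift by Suc. *)

definition qLi :: "real \<Rightarrow> nat \<Rightarrow> real \<Rightarrow> real" where
  "qLi q k x = (\<Sum>m. x ^ Suc m / qbracket q (Suc m) ^ k)"

(* ln[1 - x] = - Li_1[x], written as a function of y = 1 - x. *)
definition qln :: "real \<Rightarrow> real \<Rightarrow> real" where
  "qln q y = - qLi q 1 (1 - y)"

(* The list holds the columns (k_i, x_i) to the left of the bar in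
   S[k_1,...,k_n; x_1,...,x_n | k; x]. *)
definition qS :: "real \<Rightarrow> (nat \<times> real) list \<Rightarrow> nat \<Rightarrow> real \<Rightarrow> real" where
  "qS q cols k x =
    (\<Sum>m. (\<Prod>(k', x') \<leftarrow> cols. qzeta q (Suc m) k' x') / qbracket q (Suc m) ^ k * x ^ Suc m)"

end

theory Submission
  imports Defs "HOL-Analysis.Elementary_Metric_Spaces" "HOL-Analysis.Infinite_Sum"
    "HOL-Computational_Algebra.Formal_Power_Series"
begin

text \<open>
  Put \<open>u = q\<^sup>h\<close> and \<open>v = q\<^sup>s\<close>. Both sides come from the double series
  \<open>F = \<Sum>\<^sub>n \<Sum>\<^sub>m \<zeta>\<^sub>n[k,u] v\<^sup>m x\<^sup>n\<^sup>+\<^sup>m / ([m]\<^sup>l [n+m])\<close>. The coefficient of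
  \<open>x\<^sup>N / [N]\<close> in \<open>F\<close> is the sum of \<open>u\<^sup>i v\<^sup>m / ([i]\<^sup>k [m]\<^sup>l)\<close> over \<open>i + m \<le> N\<close>, so \<open>F\<close> does not
  change when \<open>(k,u)\<close> and \<open>(l,v)\<close> are exchanged. On the other hand \<open>[n+m] = [n] + q\<^sup>n [m]\<close> yields
  the partial fractions \<open>1 / ([m][n+m]) = (1/[m] - q\<^sup>n/[n+m]) / [n]\<close>; applying them \<open>l\<close> times
  to the inner sum expands \<open>F\<close> into the terms of the identity that carry \<open>(-1)\<^sup>l\<close> and
  \<open>Li\<^sub>l\<^sub>+\<^sub>1\<^sub>-\<^sub>j\<close>, where the logarithm and \<open>\<zeta>\<^sub>n[1,vx]\<close> come from the remaining tail
  \<open>\<Sum>\<^sub>m (vx)\<^sup>n\<^sup>+\<^sup>m / [n+m] = Li\<^sub>1[vx] - \<zeta>\<^sub>n[1,vx]\<close>. Equating the two expansions of \<open>F\<close>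
  gives the theorem.
\<close>

section \<open>Elementary bounds for q-brackets and truncated sums\<close>

lemma qbracket_ge_1:
  assumes "0 < q" "q < 1" "m > 0"
  shows "qbracket q m \<ge> 1"
proof -
  have "q ^ m \<le> q ^ 1"
    using assms by (intro power_decreasing) auto
  then show ?thesis
    using assms by (simp add: qbracket_def)
qed

lemma qbracket_add: "qbracket q (n + m) = qbracket q n + q ^ n * qbracket q m"
  by (simp add: qbracket_def power_add diff_divide_distrib right_diff_distrib
      flip: add_divide_distrib)

lemma abs_divide_qbracket_le:
  assumes "0 < q" "q < 1" "m > 0"
  shows "\<bar>a / qbracket q m ^ k\<bar> \<le> \<bar>a\<bar>"
proof -
  have "qbracket q m ^ k \<ge> 1"
    using qbracket_ge_1[OF assms] by simp
  then show ?thesis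
    by (simp add: divide_le_eq mult_left_le_one_le mult_le_cancel_left1)
qed

lemma qzeta_Suc: "qzeta q (Suc n) k x = (\<Sum>i\<le>n. x ^ Suc i / qbracket q (Suc i) ^ k)"
  unfolding qzeta_def
  using sum.atLeast_Suc_atMost_Suc_shift[of "\<lambda>j. x ^ j / qbracket q j ^ k" 0 n]
  by (simp add: atMost_atLeast0)

lemma abs_qzeta_le:
  assumes "0 < q" "q < 1" "\<bar>x\<bar> \<le> 1"
  shows "\<bar>qzeta q n k x\<bar> \<le> real n"
proof -
  have "\<bar>qzeta q n k x\<bar> \<le> (\<Sum>j=1..n. \<bar>x ^ j / qbracket q j ^ k\<bar>)"
    unfolding qzeta_def by (rule sum_abs)
  also have "\<dots> \<le> (\<Sum>j=1..n. 1)"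
  proof (rule sum_mono)
    fix j assume "j \<in> {1..n}"
    then have "\<bar>x ^ j / qbracket q j ^ k\<bar> \<le> \<bar>x ^ j\<bar>"
      using assms by (intro abs_divide_qbracket_le) auto
    also have "\<dots> \<le> 1"
      using assms by (simp add: power_abs power_le_one)
    finally show "\<bar>x ^ j / qbracket q j ^ k\<bar> \<le> 1" .
  qed
  finally show ?thesis by simp
qed

section \<open>Convergence of the single series\<close>

lemma summable_qLi:
  assumes "0 < q" "q < 1" "\<bar>y\<bar> < 1"
  shows "summable (\<lambda>m. y ^ Suc m / qbracket q (Suc m) ^ k)"
proof (rule summable_comparison_test')
  show "summable (\<lambda>m. \<bar>y\<bar> ^ Suc m)"
    unfolding summable_Suc_iff using assms(3) by (intro summable_geometric) simp
  show "norm (y ^ Suc m / qbracket q (Suc m) ^ k) \<le> \<bar>y\<bar> ^ Suc m" for m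
    unfolding real_norm_def power_abs[symmetric]
    by (intro abs_divide_qbracket_le assms) auto
qed

lemma summable_qLi_shifted:
  assumes q: "0 < q" "q < 1" and y: "\<bar>y\<bar> < 1"
  shows "summable (\<lambda>m. y ^ Suc m / qbracket q (Suc m) ^ k / qbracket q (n + Suc m))"
proof (rule summable_comparison_test')
  show "summable (\<lambda>m. \<bar>y\<bar> ^ Suc m)"
    unfolding summable_Suc_iff using y by (intro summable_geometric) simp
  show "norm (y ^ Suc m / qbracket q (Suc m) ^ k / qbracket q (n + Suc m)) \<le> \<bar>y\<bar> ^ Suc m" for m
    using abs_divide_qbracket_le[OF q, of "n + Suc m" "y ^ Suc m / qbracket q (Suc m) ^ k" 1]
      abs_divide_qbracket_le[OF q, of "Suc m" "y ^ Suc m" k]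
    unfolding real_norm_def power_abs[symmetric] by simp
qed

text \<open>Up to the factor \<open>\<bar>y\<bar>\<close> this is the differentiated geometric
  series.\<close>

lemma summable_linear_geometric:
  fixes y :: real
  assumes "\<bar>y\<bar> < 1"
  shows "summable (\<lambda>n. real (Suc n) * \<bar>y\<bar> ^ Suc n)"
proof -
  have "summable (\<lambda>n. \<bar>y\<bar> * (of_nat (Suc n) * \<bar>y\<bar> ^ n))"
    using geometric_deriv_sums[of "\<bar>y\<bar>"] assms
    by (intro summable_mult) (auto simp: summable_def simp del: of_nat_Suc)
  then show ?thesis
    by (simp add: mult_ac del: of_nat_Suc)
qed

text \<open>Brackets are at least 1, so dividing by them only shrinks the terms. This covers the
  outer series, whose coefficients \<open>qzeta\<close> grow at most linearly; the constant
  \<open>C\<close> leaves room for a further bounded factor.\<close>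

lemma summable_linear_growth:
  fixes A :: "nat \<Rightarrow> real"
  assumes q: "0 < q" "q < 1" and y: "\<bar>y\<bar> < 1"
    and A: "\<And>n. \<bar>A n\<bar> \<le> C * real (Suc n)"
  shows "summable (\<lambda>n. A n / qbracket q (Suc n) ^ j * y ^ Suc n)"
proof (rule summable_comparison_test')
  show "summable (\<lambda>n. C * (real (Suc n) * \<bar>y\<bar> ^ Suc n))"
    by (intro summable_mult summable_linear_geometric y)
  fix n
  have "norm (A n / qbracket q (Suc n) ^ j * y ^ Suc n)
      = \<bar>A n / qbracket q (Suc n) ^ j\<bar> * \<bar>y\<bar> ^ Suc n"
    by (simp add: abs_mult power_abs)
  also have "\<dots> \<le> (C * real (Suc n)) * \<bar>y\<bar> ^ Suc n"
    using abs_divide_qbracket_le[OF q, of "Suc n" "A n" j] A[of n]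
    by (intro mult_right_mono) auto
  finally show "norm (A n / qbracket q (Suc n) ^ j * y ^ Suc n)
      \<le> C * (real (Suc n) * \<bar>y\<bar> ^ Suc n)" by (simp add: mult.assoc)
qed

text \<open>These are the partial sums of the convergent series for \<open>qLi q k y\<close>. A
  uniform bound keeps the product of two truncated sums within linear growth.\<close>

lemma bounded_qzeta:
  assumes "0 < q" "q < 1" "\<bar>y\<bar> < 1"
  obtains C where "\<And>n. \<bar>qzeta q (Suc n) k y\<bar> \<le> C"
proof -
  have "convergent (\<lambda>n. qzeta q (Suc n) k y)"
    using summable_qLi[OF assms, of k] unfolding qzeta_Suc summable_iff_convergent' .
  then have "Bseq (\<lambda>n. qzeta q (Suc n) k y)"
    by (rule convergent_imp_Bseq)
  with that show ?thesis
    by (auto simp: Bseq_def)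
qed

section \<open>Rearrangement and symmetry of double series\<close>

text \<open>Fubini: both sides equal the unordered sum of \<open>f\<close>, grouped by rows on the
  left and by the diagonals \<open>n + m = N\<close> on the right.\<close>

lemma suminf_iterated_eq_diagonal:
  fixes f :: "nat \<times> nat \<Rightarrow> real"
  assumes f: "f summable_on UNIV"
  shows "(\<Sum>n. \<Sum>m. f (n, m)) = (\<Sum>N. \<Sum>n\<le>N. f (n, N - n))"
proof -
  define S where "S = infsum f UNIV"
  have S: "(f has_sum S) UNIV"
    using f by (simp add: S_def)
  have row: "((\<lambda>m. f (n, m)) has_sum (\<Sum>m. f (n, m))) UNIV" for n
  proof -
    have "(\<lambda>m. f (n, m)) summable_on UNIV"
      using summable_on_SigmaD1[of "\<lambda>n m. f (n, m)" UNIV "\<lambda>_. UNIV" n] f by simp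
    then obtain t where t: "((\<lambda>m. f (n, m)) has_sum t) UNIV"
      by (auto simp: summable_on_def)
    then show ?thesis
      using sums_unique[OF has_sum_imp_sums[OF t]] by simp
  qed
  have "((\<lambda>n. \<Sum>m. f (n, m)) has_sum S) UNIV"
    by (rule has_sum_SigmaD[where f = f and B = "\<lambda>_. UNIV"]) (use S row in auto)
  then have 1: "(\<Sum>n. \<Sum>m. f (n, m)) = S"
    by (rule sums_unique[OF has_sum_imp_sums, symmetric])
  have "((\<lambda>(N, n). f (n, N - n)) has_sum S) (SIGMA N:UNIV. {..N}) \<longleftrightarrow> (f has_sum S) UNIV"
    by (rule has_sum_reindex_bij_witness
        [where i = "\<lambda>(n, m). (n + m, n)" and j = "\<lambda>(N, n). (n, N - n)"]) auto
  with S have diag: "((\<lambda>(N, n). f (n, N - n)) has_sum S) (SIGMA N:UNIV. {..N})"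
    by blast
  have "((\<lambda>N. \<Sum>n\<le>N. f (n, N - n)) has_sum S) UNIV"
    by (rule has_sum_SigmaD[OF diag]) (auto intro: has_sum_finiteI)
  then have 2: "(\<Sum>N. \<Sum>n\<le>N. f (n, N - n)) = S"
    by (rule sums_unique[OF has_sum_imp_sums, symmetric])
  show ?thesis using 1 2 by simp
qed

lemma convolution_partial_sums_commute:
  fixes a b :: "nat \<Rightarrow> real"
  shows "(\<Sum>n\<le>N. (\<Sum>i\<le>n. a i) * b (N - n)) = (\<Sum>n\<le>N. (\<Sum>i\<le>n. b i) * a (N - n))"
proof -
  \<comment> \<open>Partial sums are convolutions with the constant sequence 1, and convolution is commutative.\<close>
  have conv: "(\<Sum>n\<le>N. (\<Sum>i\<le>n. c i) * d (N - n))
      = fps_nth (Abs_fps c * Abs_fps (\<lambda>_. 1) * Abs_fps d) N" for c d :: "nat \<Rightarrow> real"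
    by (simp add: fps_mult_nth atMost_atLeast0)
  show ?thesis
    unfolding conv by (simp add: mult_ac)
qed

text \<open>Since \<open>c\<close> depends only on \<open>n + m\<close>, summing along diagonals
  leaves a convolution as the coefficient of \<open>c N\<close>, and that convolution is symmetric
  in \<open>a\<close> and \<open>b\<close>.\<close>

lemma double_series_commute:
  fixes a b c :: "nat \<Rightarrow> real"
  assumes "\<And>i. \<bar>a i\<bar> \<le> 1" "\<And>i. \<bar>b i\<bar> \<le> 1" "\<And>N. \<bar>c N\<bar> \<le> r ^ Suc N" "0 \<le> r" "r < 1"
  shows "(\<Sum>n. \<Sum>m. (\<Sum>i\<le>n. a i) * b m * c (n + m))
       = (\<Sum>n. \<Sum>m. (\<Sum>i\<le>n. b i) * a m * c (n + m))"
proof -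
  have diag: "(\<Sum>n. \<Sum>m. (\<Sum>i\<le>n. a i) * b m * c (n + m))
      = (\<Sum>N. c N * (\<Sum>n\<le>N. (\<Sum>i\<le>n. a i) * b (N - n)))"
    if a: "\<And>i. \<bar>a i\<bar> \<le> 1" and b: "\<And>i. \<bar>b i\<bar> \<le> 1" for a b :: "nat \<Rightarrow> real"
  proof -
    define f where "f = (\<lambda>(n, m). (\<Sum>i\<le>n. a i) * b m * c (n + m))"
    \<comment> \<open>Dominating function: the partial sum of \<open>a\<close> is at most
      \<open>n + 1\<close> in absolute value, and \<open>r ^ Suc (n + m)\<close> splits into a
      factor for each index.\<close>
    define g where "g = (\<lambda>(n, m). (real (Suc n) * r ^ Suc n) * r ^ m)"
    have "g summable_on UNIV \<times> UNIV"
    proof (rule summable_on_SigmaI)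
      show "((\<lambda>m. g (n, m)) has_sum (real (Suc n) * r ^ Suc n) * (1 / (1 - r))) UNIV" for n
        unfolding g_def prod.case
        using assms(4,5) by (intro has_sum_cmult_right sums_nonneg_imp_has_sum geometric_sums) auto
      have "summable (\<lambda>n. real (Suc n) * r ^ Suc n)"
        using summable_linear_geometric[of r] assms(4,5) by simp
      then have "(\<lambda>n. real (Suc n) * r ^ Suc n) summable_on UNIV"
        using assms(4) by (subst summable_on_UNIV_nonneg_real_iff) auto
      then show "(\<lambda>n. (real (Suc n) * r ^ Suc n) * (1 / (1 - r))) summable_on UNIV"
        by (rule summable_on_cmult_left)
    qed (use assms(4) in \<open>auto simp: g_def\<close>)
    then have g: "g summable_on UNIV" by simp
    have "norm (f p) \<le> g p" for p
    proof -
      obtain n m where p: "p = (n, m)" by force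
      have "\<bar>\<Sum>i\<le>n. a i\<bar> \<le> (\<Sum>i\<le>n. 1)"
        by (rule order_trans[OF sum_abs sum_mono]) (rule a)
      then have "\<bar>\<Sum>i\<le>n. a i\<bar> * \<bar>b m\<bar> * \<bar>c (n + m)\<bar> \<le> real (Suc n) * 1 * r ^ Suc (n + m)"
        using assms(3,4) b by (intro mult_mono) auto
      then show ?thesis
        by (simp add: p f_def g_def abs_mult power_add mult_ac)
    qed
    then have "f abs_summable_on UNIV"
      by (intro summable_on_comparison_test[OF g]) auto
    then have "f summable_on UNIV"
      by (rule abs_summable_summable)
    moreover have "(\<Sum>n\<le>N. f (n, N - n)) = c N * (\<Sum>n\<le>N. (\<Sum>i\<le>n. a i) * b (N - n))" for N
      unfolding sum_distrib_left[of "c N"] f_def by (intro sum.cong) auto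
    ultimately show ?thesis
      using suminf_iterated_eq_diagonal[of f] by (simp add: f_def)
  qed
  show ?thesis
    using assms(1,2) by (simp add: diag convolution_partial_sums_commute[of a])
qed

section \<open>Expansion of the double series by partial fractions\<close>

text \<open>One partial fraction step gives
  \<open>R (Suc l) = (qLi q (Suc l) y - q ^ n * R l) / qbracket q n\<close>; iterating it down to
  \<open>R 0\<close> produces the alternating sum.\<close>

lemma suminf_shifted_partial_fraction:
  assumes q: "0 < q" "q < 1" and y: "\<bar>y\<bar> < 1" and n: "n > 0"
  defines "R \<equiv> \<lambda>l. \<Sum>m. y ^ Suc m / qbracket q (Suc m) ^ l / qbracket q (n + Suc m)"
  shows "R l = (\<Sum>j=1..l. (-1) ^ (j - 1) * q ^ ((j - 1) * n) / qbracket q n ^ j * qLi q (l + 1 - j) y)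
            + (-1) ^ l * q ^ (l * n) / qbracket q n ^ l * R 0"
proof (induction l)
  case 0
  show ?case by simp
next
  case (Suc l)
  have nz: "qbracket q m \<noteq> 0" if "m > 0" for m
    using qbracket_ge_1[OF q that] by simp
  note sR = summable_qLi_shifted[OF q y, of l n]
  have pf: "y ^ Suc m / qbracket q (Suc m) ^ Suc l / qbracket q (n + Suc m)
      = (y ^ Suc m / qbracket q (Suc m) ^ Suc l
         - q ^ n * (y ^ Suc m / qbracket q (Suc m) ^ l / qbracket q (n + Suc m))) / qbracket q n" for m
  proof -
    \<comment> \<open>Here \<open>a\<close> and \<open>b\<close> stand for the brackets at
      \<open>n\<close> and \<open>Suc m\<close>, \<open>B\<close> for \<open>b ^ l\<close> and
      \<open>Q\<close> for \<open>q ^ n\<close>, so that \<open>a + Q * b\<close> is the bracket at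
      \<open>n + Suc m\<close>.\<close>
    have *: "Y / (B * b) / (a + Q * b) = (Y / (B * b) - Q * (Y / B / (a + Q * b))) / a"
      if "a \<noteq> 0" "b \<noteq> 0" "B \<noteq> 0" "a + Q * b \<noteq> 0" for Y B Q a b :: real
    proof -
      have "Y / (B * b) - Q * (Y / B / (a + Q * b)) = a * (Y / (B * b) / (a + Q * b))"
        using that by (simp add: divide_simps) (simp add: algebra_simps)
      then show ?thesis using that by simp
    qed
    show ?thesis
      using *[of "qbracket q n" "qbracket q (Suc m)" "qbracket q (Suc m) ^ l" "q ^ n" "y ^ Suc m"]
        nz n nz[of "n + Suc m"] nz[of "Suc m"] by (simp only: qbracket_add power_Suc2) simp
  qed
  have "R (Suc l) = (qLi q (Suc l) y - q ^ n * R l) / qbracket q n"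
    unfolding R_def qLi_def pf
    by (intro sums_unique[symmetric] sums_divide sums_diff sums_mult summable_sums sR summable_qLi q y)
  also have "\<dots> = (qLi q (Suc l) y / qbracket q n
      + (\<Sum>j=1..l. (-1) ^ j * q ^ (j * n) / qbracket q n ^ Suc j * qLi q (l + 1 - j) y))
      + (-1) ^ Suc l * q ^ (Suc l * n) / qbracket q n ^ Suc l * R 0"
  proof -
    have "(-1) ^ j * q ^ (j * n) / qbracket q n ^ Suc j * L
        = - (q ^ n * ((-1) ^ (j - 1) * q ^ ((j - 1) * n) / qbracket q n ^ j * L)) / qbracket q n"
      if "j \<in> {1..l}" for j L
      using that by (cases j) (auto simp: power_add mult_ac)
    then have "(\<Sum>j=1..l. (-1) ^ j * q ^ (j * n) / qbracket q n ^ Suc j * qLi q (l + 1 - j) y)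
      = - (q ^ n * (\<Sum>j=1..l. (-1) ^ (j - 1) * q ^ ((j - 1) * n) / qbracket q n ^ j
            * qLi q (l + 1 - j) y)) / qbracket q n"
      by (simp add: sum_distrib_left sum_divide_distrib flip: sum_negf)
    then show ?thesis
      by (simp only: Suc.IH)
        (simp add: diff_divide_distrib add_divide_distrib ring_distribs power_add mult_ac)
  qed
  \<comment> \<open>The detached term is the case \<open>j = 0\<close> of the sum after it; moving
    the index up by one merges the two.\<close>
  also have "qLi q (Suc l) y / qbracket q n
      + (\<Sum>j=1..l. (-1) ^ j * q ^ (j * n) / qbracket q n ^ Suc j * qLi q (l + 1 - j) y)
      = (\<Sum>j=1..Suc l. (-1) ^ (j - 1) * q ^ ((j - 1) * n) / qbracket q n ^ j * qLi q (Suc l + 1 - j) y)"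
    by (simp only: sum.atLeast_Suc_atMost_Suc_shift One_nat_def sum.atLeast_Suc_atMost[of 0 l, OF le0])
      (simp add: sum.atLeast_Suc_atMost)
  finally show ?case .
qed

text \<open>Multiplying by \<open>y ^ Suc n\<close> turns the series into the tail of the series for
  \<open>qLi q 1 y\<close> after its first \<open>Suc n\<close> terms.\<close>

lemma suminf_shifted_eq_qLi_diff:
  assumes q: "0 < q" "q < 1" and y: "\<bar>y\<bar> < 1"
  shows "y ^ Suc n * (\<Sum>m. y ^ Suc m / qbracket q (Suc n + Suc m))
       = qLi q 1 y - qzeta q (Suc n) 1 y"
proof -
  let ?f = "\<lambda>m. y ^ Suc m / qbracket q (Suc m) ^ 1"
  have s: "summable ?f" by (rule summable_qLi[OF q y])
  have "y ^ Suc n * (\<Sum>m. y ^ Suc m / qbracket q (Suc n + Suc m)) = (\<Sum>m. ?f (m + Suc n))"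
  proof -
    have "?f (m + Suc n) = y ^ Suc n * (y ^ Suc m / qbracket q (Suc n + Suc m))" for m
      by (simp add: power_add add_ac mult_ac)
    then show ?thesis
      using suminf_mult[OF summable_qLi_shifted[OF q y, of 0 "Suc n"], of "y ^ Suc n"]
      by (simp only: power_0 div_by_1)
  qed
  also have "\<dots> = (\<Sum>m. ?f m) - (\<Sum>i<Suc n. ?f i)"
    by (rule suminf_minus_initial_segment[OF s])
  finally show ?thesis
    by (simp add: qLi_def qzeta_Suc lessThan_Suc_atMost)
qed

text \<open>The partial fraction expansion is applied to the inner sum for each \<open>n\<close>,
  then summed over \<open>n\<close> term by term. In the application \<open>v\<close> and
  \<open>z\<close> are the powers of \<open>q\<close> with exponents \<open>s\<close> and
  \<open>l - s\<close>.\<close>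

lemma double_series_expansion:
  fixes A :: "nat \<Rightarrow> real"
  assumes q: "0 < q" "q < 1" and x: "\<bar>x\<bar> < 1" and v: "\<bar>v\<bar> \<le> 1" and z: "\<bar>z\<bar> < 1"
    and vz: "v * z = q ^ l" and l: "l > 0"
    and A: "\<And>n. \<bar>A n\<bar> \<le> real (Suc n)"
  defines "T \<equiv> \<lambda>j y. \<Sum>n. A n / qbracket q (Suc n) ^ j * y ^ Suc n"
  shows "(\<Sum>n. \<Sum>m. A n * (v ^ Suc m / qbracket q (Suc m) ^ l)
            * (x ^ (Suc n + Suc m) / qbracket q (Suc n + Suc m)))
       = (\<Sum>j=1..l-1. (-1) ^ (j - 1) * qLi q (l + 1 - j) (v * x) * T j (q ^ (j - 1) * x))
         + (-1) ^ (l - 1) * qln q (1 - v * x) * (T l z - T l (q ^ (l - 1) * x))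
         + (-1) ^ (l - 1) * (\<Sum>n. A n * qzeta q (Suc n) 1 (v * x) / qbracket q (Suc n) ^ l * z ^ Suc n)"
proof -
  define y where "y = v * x"
  define Z where "Z = (\<Sum>n. A n * qzeta q (Suc n) 1 y / qbracket q (Suc n) ^ l * z ^ Suc n)"
  define R where "R n k = (\<Sum>m. y ^ Suc m / qbracket q (Suc m) ^ k / qbracket q (Suc n + Suc m))" for n k
  have y: "\<bar>y\<bar> < 1"
    using mult_mono[OF v order_refl, of "\<bar>x\<bar>"] x by (simp add: y_def abs_mult)
  have T: "(\<lambda>n. A n / qbracket q (Suc n) ^ j * w ^ Suc n) sums T j w" if "\<bar>w\<bar> < 1" for j w
    unfolding T_def using summable_linear_growth[OF q that, of A 1] A
    by (intro summable_sums) auto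
  have qx: "\<bar>q ^ j * x\<bar> < 1" for j
    using mult_mono[of "q ^ j" 1 "\<bar>x\<bar>" "\<bar>x\<bar>"] q x by (simp add: abs_mult power_le_one)
  have Z: "(\<lambda>n. A n * qzeta q (Suc n) 1 y / qbracket q (Suc n) ^ l * z ^ Suc n) sums Z"
  proof -
    obtain C where C: "\<bar>qzeta q (Suc n) 1 y\<bar> \<le> C" for n
      using bounded_qzeta[OF q y] by blast
    have "\<bar>A n * qzeta q (Suc n) 1 y\<bar> \<le> C * real (Suc n)" for n
      using mult_mono[OF A[of n] C[of n]] by (simp add: abs_mult mult.commute del: of_nat_Suc)
    from summable_linear_growth[OF q z this] show ?thesis
      unfolding Z_def by (rule summable_sums)
  qed
  have inner: "(\<Sum>m. A n * (v ^ Suc m / qbracket q (Suc m) ^ l)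
        * (x ^ (Suc n + Suc m) / qbracket q (Suc n + Suc m)))
      = (\<Sum>j=1..l. (-1) ^ (j - 1) * qLi q (l + 1 - j) y
            * (A n / qbracket q (Suc n) ^ j * (q ^ (j - 1) * x) ^ Suc n))
        + (-1) ^ l * (qLi q 1 y * (A n / qbracket q (Suc n) ^ l * z ^ Suc n)
            - A n * qzeta q (Suc n) 1 y / qbracket q (Suc n) ^ l * z ^ Suc n)" for n
  proof -
    have "(\<Sum>m. A n * (v ^ Suc m / qbracket q (Suc m) ^ l)
        * (x ^ (Suc n + Suc m) / qbracket q (Suc n + Suc m))) = A n * x ^ Suc n * R n l"
      unfolding R_def suminf_mult[OF summable_qLi_shifted[OF q y], symmetric]
      by (simp only: y_def power_mult_distrib power_add) (simp add: mult_ac)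
    also have "R n l = (\<Sum>j=1..l. (-1) ^ (j - 1) * q ^ ((j - 1) * Suc n) / qbracket q (Suc n) ^ j
            * qLi q (l + 1 - j) y)
          + (-1) ^ l * q ^ (l * Suc n) / qbracket q (Suc n) ^ l * R n 0"
      unfolding R_def by (rule suminf_shifted_partial_fraction[OF q y]) simp
    also have "A n * x ^ Suc n * \<dots>
        = (\<Sum>j=1..l. (-1) ^ (j - 1) * qLi q (l + 1 - j) y
            * (A n / qbracket q (Suc n) ^ j * (q ^ (j - 1) * x) ^ Suc n))
          + (-1) ^ l * A n / qbracket q (Suc n) ^ l * ((q ^ l) ^ Suc n * x ^ Suc n * R n 0)"
      by (simp only: distrib_left sum_distrib_left power_mult power_mult_distrib) (simp add: mult_ac)
    \<comment> \<open>Writing \<open>q ^ l\<close> as \<open>v * z\<close> moves \<open>v\<close>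
      over to \<open>x\<close>, which supplies the power of \<open>y = v * x\<close> that makes
      \<open>R n 0\<close> a tail.\<close>
    also have "(q ^ l) ^ Suc n * x ^ Suc n * R n 0 = z ^ Suc n * (y ^ Suc n * R n 0)"
      unfolding vz[symmetric] y_def by (simp only: power_mult_distrib mult_ac)
    also have "y ^ Suc n * R n 0 = qLi q 1 y - qzeta q (Suc n) 1 y"
      using suminf_shifted_eq_qLi_diff[OF q y, of n] by (simp add: R_def)
    finally show ?thesis
      by (simp add: algebra_simps diff_divide_distrib)
  qed
  have "(\<lambda>n. (\<Sum>j=1..l. (-1) ^ (j - 1) * qLi q (l + 1 - j) y
            * (A n / qbracket q (Suc n) ^ j * (q ^ (j - 1) * x) ^ Suc n))
        + (-1) ^ l * (qLi q 1 y * (A n / qbracket q (Suc n) ^ l * z ^ Suc n)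
            - A n * qzeta q (Suc n) 1 y / qbracket q (Suc n) ^ l * z ^ Suc n))
     sums ((\<Sum>j=1..l. (-1) ^ (j - 1) * qLi q (l + 1 - j) y * T j (q ^ (j - 1) * x))
        + (-1) ^ l * (qLi q 1 y * T l z - Z))"
    by (intro sums_add sums_diff sums_mult sums_sum T Z qx z)
  then have "(\<Sum>n. \<Sum>m. A n * (v ^ Suc m / qbracket q (Suc m) ^ l)
            * (x ^ (Suc n + Suc m) / qbracket q (Suc n + Suc m)))
      = (\<Sum>j=1..l. (-1) ^ (j - 1) * qLi q (l + 1 - j) y * T j (q ^ (j - 1) * x))
        + (-1) ^ l * (qLi q 1 y * T l z - Z)"
    unfolding inner by (rule sums_unique[symmetric])
  \<comment> \<open>The term \<open>j = l\<close> carries \<open>qLi q 1 y\<close>, the negative of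
    the logarithm, and joins the term with \<open>T l z\<close> to form the difference.\<close>
  also have "\<dots> = (\<Sum>j=1..l-1. (-1) ^ (j - 1) * qLi q (l + 1 - j) y * T j (q ^ (j - 1) * x))
         + (-1) ^ (l - 1) * qln q (1 - y) * (T l z - T l (q ^ (l - 1) * x)) + (-1) ^ (l - 1) * Z"
    using l by (cases l) (simp_all add: qln_def algebra_simps)
  finally show ?thesis
    by (simp add: y_def Z_def)
qed

section \<open>Equating the two expansions of the symmetric double series\<close>

theorem theorem1p2:
  fixes q s h x :: real and k l :: nat
  assumes "0 < q" and "q < 1"
    and "k > 0" and "l > 0"
    and "real l > s" and "s \<ge> 0"
    and "real k > h" and "h \<ge> 0"
    and "\<bar>x\<bar> < 1"
  shows
    "(-1) ^ (k - 1) * qS q [(l, q powr s), (1, q powr h * x)] k (q powr (real k - h))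
      - (-1) ^ (l - 1) * qS q [(k, q powr h), (1, q powr s * x)] l (q powr (real l - s))
    = (\<Sum>j = 1..l - 1. (-1) ^ (j - 1) * qLi q (l + 1 - j) (q powr s * x)
          * qS q [(k, q powr h)] j (q ^ (j - 1) * x))
      - (\<Sum>j = 1..k - 1. (-1) ^ (j - 1) * qLi q (k + 1 - j) (q powr h * x)
          * qS q [(l, q powr s)] j (q ^ (j - 1) * x))
      + (-1) ^ (l - 1) * qln q (1 - q powr s * x)
          * (qS q [(k, q powr h)] l (q powr (real l - s))
             - qS q [(k, q powr h)] l (q ^ (l - 1) * x))
      - (-1) ^ (k - 1) * qln q (1 - q powr h * x)
          * (qS q [(l, q powr s)] k (q powr (real k - h))
             - qS q [(l, q powr s)] k (q ^ (k - 1) * x))"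
proof -
  have q: "0 < q" "q < 1" by fact+
  define u where "u = q powr h"
  define v where "v = q powr s"
  define F where "F k u l v = (\<Sum>n. \<Sum>m. qzeta q (Suc n) k u * (v ^ Suc m / qbracket q (Suc m) ^ l)
            * (x ^ (Suc n + Suc m) / qbracket q (Suc n + Suc m)))" for k l u v
  have bounds: "0 < q powr t" "q powr t \<le> 1" if "t \<ge> 0" for t
    using q that powr_mono'[of 0 t q] by auto
  \<comment> \<open>Applied to \<open>l - s\<close> and \<open>k - h\<close>, this is where the
    strict inequalities yield convergence of the outer series.\<close>
  have less_1: "\<bar>q powr t\<bar> < 1" if "t > 0" for t
    using q that powr_less_mono'[of q 0 t] by auto
  have uv: "\<bar>u\<bar> \<le> 1" "\<bar>v\<bar> \<le> 1"
    using bounds assms by (auto simp: u_def v_def)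
  have powers: "u * q powr (real k - h) = q ^ k" "v * q powr (real l - s) = q ^ l"
    using q by (simp_all add: u_def v_def powr_realpow flip: powr_add)
  have expansion: "F k u l v
      = (\<Sum>j=1..l-1. (-1) ^ (j - 1) * qLi q (l + 1 - j) (v * x) * qS q [(k, u)] j (q ^ (j - 1) * x))
        + (-1) ^ (l - 1) * qln q (1 - v * x) * (qS q [(k, u)] l z - qS q [(k, u)] l (q ^ (l - 1) * x))
        + (-1) ^ (l - 1) * qS q [(k, u), (1, v * x)] l z"
    if "l > 0" "\<bar>u\<bar> \<le> 1" "\<bar>v\<bar> \<le> 1" "\<bar>z\<bar> < 1" "v * z = q ^ l" for k l u v z
    using double_series_expansion[OF q \<open>\<bar>x\<bar> < 1\<close> that(3,4,5,1), of "\<lambda>n. qzeta q (Suc n) k u"]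
      abs_qzeta_le[OF q that(2)]
    by (simp only: F_def qS_def) simp
  have "F k u l v = F l v k u"
  proof -
    \<comment> \<open>Both indices start at 0 and stand for their successors, so the diagonal
      \<open>n + m = N\<close> carries the exponent \<open>N + 2\<close>.\<close>
    define c where "c N = x ^ Suc (Suc N) / qbracket q (Suc (Suc N))" for N
    have bound: "\<bar>w ^ Suc i / qbracket q (Suc i) ^ j\<bar> \<le> 1" if "\<bar>w\<bar> \<le> 1" for w :: real and i j
      using abs_divide_qbracket_le[OF q, of "Suc i" "w ^ Suc i" j]
        power_le_one[OF abs_ge_zero that, of "Suc i"] unfolding power_abs[symmetric] by linarith
    have c: "\<bar>c N\<bar> \<le> \<bar>x\<bar> ^ Suc N" for N
    proof -
      have "\<bar>c N\<bar> \<le> \<bar>x\<bar> ^ Suc (Suc N)"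
        using abs_divide_qbracket_le[OF q, of "Suc (Suc N)" "x ^ Suc (Suc N)" 1]
        by (simp only: c_def power_abs power_one_right)
      also have "\<dots> \<le> \<bar>x\<bar> ^ Suc N"
        using \<open>\<bar>x\<bar> < 1\<close> by (intro power_decreasing) auto
      finally show ?thesis .
    qed
    show ?thesis
      using double_series_commute[of "\<lambda>i. u ^ Suc i / qbracket q (Suc i) ^ k"
          "\<lambda>i. v ^ Suc i / qbracket q (Suc i) ^ l" c "\<bar>x\<bar>", OF bound bound c] uv \<open>\<bar>x\<bar> < 1\<close>
      by (simp only: F_def qzeta_Suc c_def add_Suc_right add_Suc)
  qed
  moreover note expansion[of l u v "q powr (real l - s)" k]
    expansion[of k v u "q powr (real k - h)" l]
  ultimately show ?thesis
    using uv powers assms less_1[of "real l - s"] less_1[of "real k - h"]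
    by (simp flip: u_def v_def)
qed

end
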